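(* Let $G$ be a finitely generated group that is a central extension $$1 \to Z \to G \to A \to 1$$ (that is, the sequence is exact and the image of $Z$ lies in the center of $G$), where $A$ is abelian and $Z \cong \mathbb{Z}^m \times T$ with $T$ a finite abelian group. Then the conjugator length function of $G$ satisfies $\mathrm{CL}(n) \preceq n^{m+1}$.
   Context: Let $G$ be a group with a fixed finite generating set $S$. Words are finite words in the letters $S^{\pm 1}$, and $|w|$ denotes the length of a word $w$. Write $u \sim v$ if the words $u$ and $v$ represent conjugate elements of $G$. For words $u \sim v$, let $\mathrm{CL}(u,v)$ be the length of a shortest word $w$ such that $uw = wv$ in $G$. The conjugator length function $\mathrm{CL} : \mathbb{N} \to \mathbb{N}$ of $G$ is $$\mathrm{CL}(n) = \max\{\mathrm{CL}(u,v) \mid \text{words } u, v \text{ with } u \sim v \text{ in } G \text{ and } |u|+|v| \leq n\}.$$ For functions $f,g : \mathbb{N} \to \mathbb{N}$, write $f \preceq g$ if there exists a constant $C>0$ (which may be taken to be an integer) such that $f(n) \leq C g(Cn+C) + C$ for all $n \in \mathbb{N}$; write $f \simeq g$ if $f \preceq g$ and $g \preceq f$. The $\simeq$-class of $\mathrm{CL}$ does not depend on the choice of finite generating set. *)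

theory Defs
  imports "HOL-Algebra.Algebra"
begin

text \<open>
  A letter \<open>(s, True)\<close> stands for \<open>s\<close> and \<open>(s, False)\<close> for the formal inverse of \<open>s\<close>.
\<close>

definition words :: "'a set \<Rightarrow> ('a \<times> bool) list set" where
  "words S = lists (S \<times> UNIV)"

definition letter_val :: "('a, 'b) monoid_scheme \<Rightarrow> 'a \<times> bool \<Rightarrow> 'a" where
  "letter_val G x = (if snd x then fst x else inv\<^bsub>G\<^esub> (fst x))"

definition word_val :: "('a, 'b) monoid_scheme \<Rightarrow> ('a \<times> bool) list \<Rightarrow> 'a" where
  "word_val G w = foldr (\<lambda>x g. letter_val G x \<otimes>\<^bsub>G\<^esub> g) w \<one>\<^bsub>G\<^esub>"

definition conj_words ::
    "('a, 'b) monoid_scheme \<Rightarrow> ('a \<times> bool) list \<Rightarrow> ('a \<times> bool) list \<Rightarrow> bool" where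
  "conj_words G u v \<longleftrightarrow>
     (\<exists>g\<in>carrier G. word_val G v = inv\<^bsub>G\<^esub> g \<otimes>\<^bsub>G\<^esub> word_val G u \<otimes>\<^bsub>G\<^esub> g)"

definition CL_words ::
    "('a, 'b) monoid_scheme \<Rightarrow> 'a set \<Rightarrow> ('a \<times> bool) list \<Rightarrow> ('a \<times> bool) list \<Rightarrow> nat" where
  "CL_words G S u v =
     (LEAST k. \<exists>w\<in>words S. length w = k \<and>
        word_val G u \<otimes>\<^bsub>G\<^esub> word_val G w = word_val G w \<otimes>\<^bsub>G\<^esub> word_val G v)"

definition CL_set :: "('a, 'b) monoid_scheme \<Rightarrow> 'a set \<Rightarrow> nat \<Rightarrow> nat set" where
  "CL_set G S n =
     {CL_words G S u v | u v.
        u \<in> words S \<and> v \<in> words S \<and> conj_words G u v \<and> length u + length v \<le> n}"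

definition CL :: "('a, 'b) monoid_scheme \<Rightarrow> 'a set \<Rightarrow> nat \<Rightarrow> nat" where
  "CL G S n = Max (CL_set G S n)"

definition asymp_le :: "(nat \<Rightarrow> nat) \<Rightarrow> (nat \<Rightarrow> nat) \<Rightarrow> bool" (infix \<open>\<preceq>\<close> 50) where
  "f \<preceq> g \<longleftrightarrow> (\<exists>C>0. \<forall>n. f n \<le> C * g (C * n + C) + C)"

text \<open>
  The library's \<open>exact_seq\<close> forces all groups of the sequence to share one carrier type, so
  exactness of \<open>1 \<rightarrow> Z \<rightarrow> G \<rightarrow> A \<rightarrow> 1\<close> is spelled out term by term.
\<close>

definition central_extension ::
    "('z, 'b) monoid_scheme \<Rightarrow> ('z \<Rightarrow> 'g) \<Rightarrow> ('g, 'c) monoid_scheme \<Rightarrow> ('g \<Rightarrow> 'a) \<Rightarrow>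
     ('a, 'd) monoid_scheme \<Rightarrow> bool" where
  "central_extension Z \<iota> G \<pi> A \<longleftrightarrow>
     group Z \<and> group G \<and> group A \<and>
     \<iota> \<in> mon Z G \<and> \<pi> \<in> epi G A \<and> kernel G A \<pi> = \<iota> ` carrier Z \<and>
     (\<forall>z\<in>carrier Z. \<forall>g\<in>carrier G. \<iota> z \<otimes>\<^bsub>G\<^esub> g = g \<otimes>\<^bsub>G\<^esub> \<iota> z)"

abbreviation free_abelian_rank :: "nat \<Rightarrow> (nat \<Rightarrow> int) monoid" where
  "free_abelian_rank m \<equiv> product_group {..<m} (\<lambda>_. integer_group)"

text \<open>
  The minimum in \<open>CL_words\<close> and the maximum in \<open>CL\<close> exist.
\<close>

lemma word_val_closed:
  assumes "group G" "S \<subseteq> carrier G" "w \<in> words S"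
  shows "word_val G w \<in> carrier G"
proof -
  interpret group G by fact
  have "w \<in> lists (S \<times> UNIV)"
    using assms(3) by (simp add: words_def)
  then show ?thesis
    using assms(2) by (induction w) (auto simp: word_val_def letter_val_def)
qed

lemma word_val_append:
  assumes "group G" "S \<subseteq> carrier G" "v \<in> words S" "w \<in> words S"
  shows "word_val G (v @ w) = word_val G v \<otimes>\<^bsub>G\<^esub> word_val G w"
proof -
  interpret group G by fact
  have "v \<in> lists (S \<times> UNIV)"
    using assms(3) by (simp add: words_def)
  then show ?thesis
  proof (induction v)
    case Nil
    then show ?case
      using word_val_closed[OF assms(1,2,4)] by (simp add: word_val_def)
  next
    case (Cons x v)
    then have "letter_val G x \<in> carrier G"
      using assms(2) by (auto simp: letter_val_def)
    moreover have "word_val G v \<in> carrier G"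
      using Cons.hyps by (intro word_val_closed[OF assms(1,2)]) (simp add: words_def)
    ultimately show ?case
      using word_val_closed[OF assms(1,2,4)] Cons.IH
      by (simp add: word_val_def m_assoc)
  qed
qed

lemma word_val_surj:
  assumes "group G" "S \<subseteq> carrier G" "g \<in> generate G S"
  shows "\<exists>w\<in>words S. word_val G w = g"
proof -
  interpret group G by fact
  from assms(3) show ?thesis
  proof (induction rule: generate.induct)
    case one
    show ?case by (rule bexI[of _ "[]"]) (auto simp: word_val_def words_def)
  next
    case (incl h)
    then show ?case using assms(2)
      by (intro bexI[of _ "[(h, True)]"]) (auto simp: word_val_def words_def letter_val_def)
  next
    case (inv h)
    then show ?case using assms(2)
      by (intro bexI[of _ "[(h, False)]"]) (auto simp: word_val_def words_def letter_val_def)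
  next
    case (eng h1 h2)
    then obtain w1 w2 where "w1 \<in> words S" "w2 \<in> words S"
      "word_val G w1 = h1" "word_val G w2 = h2" by blast
    then show ?case
      using word_val_append[OF assms(1,2), of w1 w2]
      by (intro bexI[of _ "w1 @ w2"]) (auto simp: words_def)
  qed
qed

lemma CL_words_witness:
  assumes "group G" "S \<subseteq> carrier G" "generate G S = carrier G"
    and "u \<in> words S" "v \<in> words S" "conj_words G u v"
  shows "\<exists>w\<in>words S. length w = CL_words G S u v \<and>
    word_val G u \<otimes>\<^bsub>G\<^esub> word_val G w = word_val G w \<otimes>\<^bsub>G\<^esub> word_val G v"
proof -
  interpret group G by fact
  obtain g where g: "g \<in> carrier G" "word_val G v = inv\<^bsub>G\<^esub> g \<otimes>\<^bsub>G\<^esub> word_val G u \<otimes>\<^bsub>G\<^esub> g"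
    using assms(6) by (auto simp: conj_words_def)
  obtain w where w: "w \<in> words S" "word_val G w = g"
    using word_val_surj[OF assms(1,2)] assms(3) g(1) by blast
  have "word_val G u \<otimes>\<^bsub>G\<^esub> g = g \<otimes>\<^bsub>G\<^esub> word_val G v"
    using g word_val_closed[OF assms(1,2,4)]
    by (simp add: m_assoc[symmetric])
  with w have "\<exists>k. \<exists>w\<in>words S. length w = k \<and>
      word_val G u \<otimes>\<^bsub>G\<^esub> word_val G w = word_val G w \<otimes>\<^bsub>G\<^esub> word_val G v"
    by blast
  then show ?thesis
    unfolding CL_words_def by (rule LeastI_ex)
qed

lemma finite_CL_set:
  assumes "finite S"
  shows "finite (CL_set G S n)"
proof -
  let ?B = "{w. set w \<subseteq> S \<times> (UNIV :: bool set) \<and> length w \<le> n}"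
  have "finite ?B"
    using assms by (intro finite_lists_length_le) simp
  then have "finite ((\<lambda>(u, v). CL_words G S u v) ` (?B \<times> ?B))"
    by simp
  moreover have "CL_set G S n \<subseteq> (\<lambda>(u, v). CL_words G S u v) ` (?B \<times> ?B)"
    by (fastforce simp: CL_set_def words_def lists_eq_set)
  ultimately show ?thesis
    by (rule finite_subset[rotated])
qed

lemma CL_set_nonempty:
  assumes "group G"
  shows "CL_set G S n \<noteq> {}"
proof -
  interpret group G by fact
  have "[] \<in> words S" "conj_words G [] []"
    by (auto simp: words_def conj_words_def word_val_def intro: bexI[of _ "\<one>\<^bsub>G\<^esub>"])
  then have "CL_words G S [] [] \<in> CL_set G S n"
    unfolding CL_set_def by force
  then show ?thesis by blast
qed

end

theory Submission
  imports Defs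
begin

text \<open>
  Since \<open>A\<close> is abelian, \<open>w \<mapsto> [u, w]\<close> is a homomorphism into the central subgroup, and \<open>u w = w v\<close> says
  \<open>[u, w] = u\<inverse> v\<close>. So one looks for a short solution of a linear equation in \<open>\<int>\<^sup>m \<times> T\<close> whose
  coefficients, the commutators of \<open>u\<close> with the letters, have size \<open>O(n)\<close>, and whose right hand side
  has size \<open>O(n\<^sup>2)\<close>.

  The quadratic bound on the right hand side comes from extending every homomorphism \<open>q\<close> from the
  central subgroup to the reals to a map \<open>F\<close> on \<open>G\<close> with \<open>F (g h) = F g + F h + q [g, h] / 2\<close>; such an
  \<open>F\<close> grows at most quadratically in the word length.

  Let \<open>x\<close> be the vector of letter multiplicities of a shortest solution and \<open>M\<close> its largest entry. The
  rounded multiples \<open>\<lfloor>t x / M\<rfloor>\<close> for \<open>0 \<le> t \<le> M\<close> are mapped to points at distance \<open>O(n)\<close> from the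
  segment joining \<open>0\<close> to the right hand side. They are pairwise distinct, because a coincidence would
  allow one to cut out a piece of the solution. Hence \<open>M\<close> is bounded by the number of lattice points
  in this tube, which is covered by \<open>O(n)\<close> boxes of side \<open>O(n)\<close>, and so is \<open>O(n\<^sup>m\<^sup>+\<^sup>1)\<close>.
\<close>

section \<open>Quadratic extensions of central functionals\<close>

definition commutator :: "('g, 'b) monoid_scheme \<Rightarrow> 'g \<Rightarrow> 'g \<Rightarrow> 'g" where
  "commutator G g h = inv\<^bsub>G\<^esub> g \<otimes>\<^bsub>G\<^esub> inv\<^bsub>G\<^esub> h \<otimes>\<^bsub>G\<^esub> g \<otimes>\<^bsub>G\<^esub> h"

text \<open>\<open>K\<close> models the image of \<open>Z\<close> in the extension; commutators land
  in it because the quotient \<open>A\<close> is abelian.\<close>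

locale central_commutators = group G for G :: "('g, 'b) monoid_scheme" (structure) +
  fixes K :: "'g set"
  assumes K: "subgroup K G"
    and central: "\<lbrakk>z \<in> K; g \<in> carrier G\<rbrakk> \<Longrightarrow> z \<otimes> g = g \<otimes> z"
    and commutator_K: "\<lbrakk>g \<in> carrier G; h \<in> carrier G\<rbrakk> \<Longrightarrow> commutator G g h \<in> K"
begin

abbreviation com :: "'g \<Rightarrow> 'g \<Rightarrow> 'g" where "com \<equiv> commutator G"

lemma K_carrier [simp]: "z \<in> K \<Longrightarrow> z \<in> carrier G"
  using K subgroup.mem_carrier by fastforce

lemma com_closed [simp]: "\<lbrakk>g \<in> carrier G; h \<in> carrier G\<rbrakk> \<Longrightarrow> com g h \<in> carrier G"
  by (simp add: commutator_def)

lemma mult_swap: "\<lbrakk>g \<in> carrier G; h \<in> carrier G\<rbrakk> \<Longrightarrow> g \<otimes> h = h \<otimes> g \<otimes> com g h"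
proof -
  assume [simp]: "g \<in> carrier G" "h \<in> carrier G"
  have cancel: "x \<otimes> (inv x \<otimes> y) = y" if "x \<in> carrier G" "y \<in> carrier G" for x y
    using that by (simp add: m_assoc[symmetric])
  show ?thesis by (simp add: commutator_def m_assoc cancel)
qed

text \<open>Reduces commutator identities to equations without inverses, which are then proved by
  moving central factors through a product.\<close>

lemma com_eqI:
  assumes "g \<in> carrier G" "h \<in> carrier G" "z \<in> carrier G" "g \<otimes> h = h \<otimes> g \<otimes> z"
  shows "com g h = z"
proof -
  have "h \<otimes> g \<otimes> com g h = h \<otimes> g \<otimes> z" by (rule trans[OF sym[OF mult_swap[OF assms(1,2)]] assms(4)])
  then show ?thesis using assms by simp
qed

text \<open>The general identity has a conjugate of \<open>com g h\<close> by \<open>g'\<close> on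
  the right; it simplifies here because \<open>com g h\<close> is central.\<close>

lemma com_mult_left:
  assumes [simp]: "g \<in> carrier G" "g' \<in> carrier G" "h \<in> carrier G"
  shows "com (g \<otimes> g') h = com g h \<otimes> com g' h"
proof (rule com_eqI)
  have "g \<otimes> g' \<otimes> h = g \<otimes> (g' \<otimes> h)" by (simp add: m_assoc)
  also have "g' \<otimes> h = h \<otimes> g' \<otimes> com g' h" by (intro mult_swap) auto
  also have "g \<otimes> (h \<otimes> g' \<otimes> com g' h) = (g \<otimes> h) \<otimes> g' \<otimes> com g' h" by (simp add: m_assoc)
  also have "g \<otimes> h = h \<otimes> g \<otimes> com g h" by (intro mult_swap) auto
  also have "h \<otimes> g \<otimes> com g h \<otimes> g' \<otimes> com g' h = h \<otimes> g \<otimes> (com g h \<otimes> g') \<otimes> com g' h" by (simp add: m_assoc)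
  also have "com g h \<otimes> g' = g' \<otimes> com g h" by (intro central commutator_K) auto
  finally show "g \<otimes> g' \<otimes> h = h \<otimes> (g \<otimes> g') \<otimes> (com g h \<otimes> com g' h)" by (simp add: m_assoc)
qed auto

text \<open>This makes the conjugacy equation linear in the conjugator.\<close>

lemma com_mult_right:
  assumes [simp]: "g \<in> carrier G" "h \<in> carrier G" "h' \<in> carrier G"
  shows "com g (h \<otimes> h') = com g h \<otimes> com g h'"
proof (rule com_eqI)
  have "g \<otimes> (h \<otimes> h') = (g \<otimes> h) \<otimes> h'" by (simp add: m_assoc)
  also have "g \<otimes> h = h \<otimes> g \<otimes> com g h" by (intro mult_swap) auto
  also have "h \<otimes> g \<otimes> com g h \<otimes> h' = h \<otimes> g \<otimes> (com g h \<otimes> h')" by (simp add: m_assoc)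
  also have "com g h \<otimes> h' = h' \<otimes> com g h" by (intro central commutator_K) auto
  also have "h \<otimes> g \<otimes> (h' \<otimes> com g h) = h \<otimes> (g \<otimes> h') \<otimes> com g h" by (simp add: m_assoc)
  also have "g \<otimes> h' = h' \<otimes> g \<otimes> com g h'" by (intro mult_swap) auto
  also have "h \<otimes> (h' \<otimes> g \<otimes> com g h') \<otimes> com g h = h \<otimes> h' \<otimes> g \<otimes> (com g h' \<otimes> com g h)" by (simp add: m_assoc)
  also have "com g h' \<otimes> com g h = com g h \<otimes> com g h'" by (intro central commutator_K) auto
  finally show "g \<otimes> (h \<otimes> h') = h \<otimes> h' \<otimes> g \<otimes> (com g h \<otimes> com g h')" .
qed auto

lemma com_self: "g \<in> carrier G \<Longrightarrow> com g g = \<one>"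
  by (rule com_eqI) auto

lemma com_central: "\<lbrakk>z \<in> K; g \<in> carrier G\<rbrakk> \<Longrightarrow> com z g = \<one>"
  by (intro com_eqI) (auto intro: central)

text \<open>Polarisation: expanding the trivial commutator of \<open>g \<otimes> h\<close> with
  itself leaves only the two mixed terms.\<close>

lemma com_swap:
  assumes [simp]: "g \<in> carrier G" "h \<in> carrier G"
  shows "com h g \<otimes> com g h = \<one>"
proof -
  have "com (g \<otimes> h) (g \<otimes> h) = \<one>" by (simp add: com_self)
  then show ?thesis by (simp add: com_mult_left com_mult_right com_self[of g] com_self[of h])
qed

end

section \<open>The alternating form attached to a real functional on the central subgroup\<close>

locale central_functional = central_commutators +
  fixes q :: "'a \<Rightarrow> real"
  assumes q_mult: "\<lbrakk>z \<in> K; z' \<in> K\<rbrakk> \<Longrightarrow> q (z \<otimes> z') = q z + q z'"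
begin

text \<open>A bi-additive alternating form that vanishes as soon as one argument lies in
  \<open>K\<close>, hence essentially a form on the abelian quotient.\<close>

definition \<omega> :: "'a \<Rightarrow> 'a \<Rightarrow> real" where "\<omega> g h = q (com g h)"

lemma q_one: "q \<one> = 0"
  using q_mult[of \<one> \<one>] subgroup.one_closed[OF K] by simp

lemma \<omega>_mult_left:
  "\<lbrakk>g \<in> carrier G; g' \<in> carrier G; h \<in> carrier G\<rbrakk> \<Longrightarrow> \<omega> (g \<otimes> g') h = \<omega> g h + \<omega> g' h"
  by (simp add: \<omega>_def com_mult_left q_mult commutator_K)

lemma \<omega>_mult_right:
  "\<lbrakk>g \<in> carrier G; h \<in> carrier G; h' \<in> carrier G\<rbrakk> \<Longrightarrow> \<omega> g (h \<otimes> h') = \<omega> g h + \<omega> g h'"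
  by (simp add: \<omega>_def com_mult_right q_mult commutator_K)

lemma \<omega>_self: "g \<in> carrier G \<Longrightarrow> \<omega> g g = 0"
  by (simp add: \<omega>_def com_self q_one)

lemma \<omega>_swap: "\<lbrakk>g \<in> carrier G; h \<in> carrier G\<rbrakk> \<Longrightarrow> \<omega> h g = - \<omega> g h"
  using q_mult[OF commutator_K commutator_K, of h g g h] by (simp add: \<omega>_def com_swap q_one)

lemma \<omega>_central: "\<lbrakk>z \<in> K; g \<in> carrier G\<rbrakk> \<Longrightarrow> \<omega> z g = 0"
  by (simp add: \<omega>_def com_central q_one)

lemma \<omega>_central_right: "\<lbrakk>z \<in> K; g \<in> carrier G\<rbrakk> \<Longrightarrow> \<omega> g z = 0"
  using \<omega>_central[of z g] \<omega>_swap[of z g] by simp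

lemma \<omega>_one: "g \<in> carrier G \<Longrightarrow> \<omega> \<one> g = 0" "g \<in> carrier G \<Longrightarrow> \<omega> g \<one> = 0"
  using \<omega>_central \<omega>_central_right subgroup.one_closed[OF K] by auto

lemma \<omega>_inv: "\<lbrakk>g \<in> carrier G; h \<in> carrier G\<rbrakk> \<Longrightarrow> \<omega> (inv g) h = - \<omega> g h"
  using \<omega>_mult_left[of g "inv g" h] by (simp add: \<omega>_one)

lemma \<omega>_pow_left:
  assumes "g \<in> carrier G" "h \<in> carrier G"
  shows "\<omega> (g [^] (a :: int)) h = of_int a * \<omega> g h"
proof -
  have "\<omega> (g [^] (k :: nat)) h = of_nat k * \<omega> g h" for k
    using assms by (induction k) (auto simp: \<omega>_one \<omega>_mult_left algebra_simps)
  then show ?thesis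
    using assms by (cases a rule: int_cases2) (auto simp: int_pow_int int_pow_neg \<omega>_inv)
qed

lemma \<omega>_pow_right:
  assumes "g \<in> carrier G" "h \<in> carrier G"
  shows "\<omega> h (g [^] (a :: int)) = of_int a * \<omega> h g"
  using \<omega>_pow_left[OF assms] \<omega>_swap[of "g [^] a" h] \<omega>_swap[of g h] assms by simp

text \<open>The factor 1/2 is the right one for an alternating correction term:
  \<open>F (g \<otimes> h)\<close> and \<open>F (h \<otimes> g)\<close> must differ by
  \<open>q (com g h)\<close>. In the Heisenberg group of triples (x, y, z) with central coordinate z
  and product cocycle x y', one such \<open>F\<close> is z - x y / 2.\<close>

definition quadratic_on :: "'a set \<Rightarrow> ('a \<Rightarrow> real) \<Rightarrow> bool" where
  "quadratic_on H F \<longleftrightarrow> (\<forall>z\<in>K. F z = q z) \<and> (\<forall>g\<in>H. \<forall>h\<in>H. F (g \<otimes> h) = F g + F h + \<omega> g h / 2)"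

lemma quadratic_on_mult:
  "\<lbrakk>quadratic_on H F; g \<in> H; h \<in> H\<rbrakk> \<Longrightarrow> F (g \<otimes> h) = F g + F h + \<omega> g h / 2"
  by (simp add: quadratic_on_def)

lemma quadratic_on_central: "\<lbrakk>quadratic_on H F; z \<in> K\<rbrakk> \<Longrightarrow> F z = q z"
  by (simp add: quadratic_on_def)

lemma quadratic_on_one: "quadratic_on H F \<Longrightarrow> F \<one> = 0"
  using quadratic_on_central subgroup.one_closed[OF K] q_one by fastforce

lemma quadratic_on_inv:
  assumes "quadratic_on H F" "subgroup H G" "h \<in> H"
  shows "F (inv h) = - F h"
proof -
  have h: "h \<in> carrier G" "inv h \<in> H" using assms subgroup.mem_carrier subgroup.m_inv_closed by fastforce+
  have "\<omega> (inv h) h = 0" using h by (simp add: \<omega>_inv \<omega>_self)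
  then show ?thesis
    using quadratic_on_mult[OF assms(1) h(2) assms(3)] h quadratic_on_one[OF assms(1)] by simp
qed

text \<open>The form vanishes on pairs of powers of one element, so \<open>F\<close> is a
  homomorphism on every cyclic subgroup of \<open>H\<close>.\<close>

lemma quadratic_on_pow:
  assumes F: "quadratic_on H F" and H: "subgroup H G" and h: "h \<in> H"
  shows "F (h [^] (a :: int)) = of_int a * F h"
proof -
  interpret H: subgroup H G by fact
  have nat: "F (h [^] (k :: nat)) = of_nat k * F h \<and> h [^] k \<in> H" for k
  proof (induction k)
    case 0
    then show ?case using quadratic_on_one[OF F] by simp
  next
    case (Suc k)
    have "\<omega> (h [^] k) h = 0"
      using \<omega>_pow_left[of h h "int k"] h by (simp add: int_pow_int \<omega>_self)
    then show ?case using Suc quadratic_on_mult[OF F, of "h [^] k" h] h by (simp add: algebra_simps)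
  qed
  then show ?thesis
    using h quadratic_on_inv[OF F H]
    by (cases a rule: int_cases2) (auto simp: int_pow_int int_pow_neg)
qed

text \<open>Provides the value \<open>\<alpha>\<close> that an extension of \<open>F\<close> will
  take at \<open>g\<close>. If a nonzero power \<open>g [^] d\<close> lies in \<open>H\<close>, this
  value is forced, and any other power \<open>g [^] c\<close> in \<open>H\<close> agrees with it by
  comparison through \<open>g [^] (c * d)\<close>.\<close>

lemma quadratic_extend_pow:
  assumes F: "quadratic_on H F" and H: "subgroup H G" and g: "g \<in> carrier G"
  obtains \<alpha> where "\<And>c :: int. g [^] c \<in> H \<Longrightarrow> F (g [^] c) = of_int c * \<alpha>"
proof (cases "\<exists>c :: int. c \<noteq> 0 \<and> g [^] c \<in> H")
  case True
  then obtain d :: int where d: "d \<noteq> 0" "g [^] d \<in> H" by blast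
  show ?thesis
  proof (rule that[of "F (g [^] d) / of_int d"])
    fix c :: int assume c: "g [^] c \<in> H"
    have "F (g [^] (c * d)) = of_int d * F (g [^] c)" "F (g [^] (c * d)) = of_int c * F (g [^] d)"
      using quadratic_on_pow[OF F H c, of d] quadratic_on_pow[OF F H d(2), of c] g
      by (simp_all add: int_pow_pow mult.commute)
    then show "F (g [^] c) = of_int c * (F (g [^] d) / of_int d)" using d by (simp add: field_simps)
  qed
next
  case False
  \<comment> \<open>Only the trivial power lies in \<open>H\<close>, so every value is consistent
    and 0 is chosen.\<close>
  show ?thesis
  proof (rule that[of 0])
    fix c :: int assume "g [^] c \<in> H"
    then have "c = 0" using False by blast
    then show "F (g [^] c) = of_int c * 0" using quadratic_on_one[OF F] by simp
  qed
qed

text \<open>Adjoins one element. Since \<open>H\<close> contains \<open>K\<close>, and so all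
  commutators, moving a power of \<open>g\<close> past an element of \<open>H\<close> costs only a
  factor in \<open>H\<close>; hence the products \<open>h \<otimes> g [^] a\<close> already form a
  subgroup.\<close>

lemma quadratic_extend:
  assumes F: "quadratic_on H F" and H: "subgroup H G" and KH: "K \<subseteq> H" and g: "g \<in> carrier G"
  shows "\<exists>H' F'. subgroup H' G \<and> H \<subseteq> H' \<and> g \<in> H' \<and> quadratic_on H' F'"
proof -
  interpret H: subgroup H G by fact
  note [simp] = g
  obtain \<alpha> where \<alpha>: "\<And>c :: int. g [^] c \<in> H \<Longrightarrow> F (g [^] c) = of_int c * \<alpha>"
    using quadratic_extend_pow[OF F H g] by blast
  \<comment> \<open>\<open>F'\<close> is forced by \<open>F' g = \<alpha>\<close>; the choice of \<open>\<alpha>\<close> makes it independent of the representation\<close>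
  define H' where "H' = {h \<otimes> g [^] (a :: int) | h a. h \<in> H}"
  define F' where "F' x = (THE r. \<exists>h\<in>H. \<exists>a :: int. x = h \<otimes> g [^] a \<and> r = F h + of_int a * \<alpha> + of_int a / 2 * \<omega> h g)" for x
  \<comment> \<open>Two representations of one element differ by \<open>g [^] (a - b)\<close>, which
    lies in \<open>H\<close>, where \<open>F\<close> is given by \<open>\<alpha>\<close>.\<close>
  have wd: "F h + a * \<alpha> + a / 2 * \<omega> h g = F h' + b * \<alpha> + b / 2 * \<omega> h' g"
    if h: "h \<in> H" "h' \<in> H" and eq: "h \<otimes> g [^] a = h' \<otimes> g [^] b" for h h' and a b :: int
  proof -
    have "h \<otimes> g [^] (a - b) = (h \<otimes> g [^] a) \<otimes> g [^] (- b)"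
      using h int_pow_mult[OF g, of a "- b"] by (simp add: m_assoc)
    also have "\<dots> = h' \<otimes> g [^] b \<otimes> g [^] (- b)" by (simp only: eq)
    also have "\<dots> = h'" using h by (simp add: m_assoc int_pow_neg)
    finally have h': "h' = h \<otimes> g [^] (a - b)" by simp
    then have "g [^] (a - b) = inv h \<otimes> h'" using h by (simp add: m_assoc[symmetric])
    then have gH: "g [^] (a - b) \<in> H" using h by simp
    have "F h' = F h + (a - b) * \<alpha> + (a - b) / 2 * \<omega> h g"
      unfolding h' using quadratic_on_mult[OF F h(1) gH] \<alpha>[OF gH] h by (simp add: \<omega>_pow_right)
    moreover have "\<omega> h' g = \<omega> h g" unfolding h' using h by (simp add: \<omega>_mult_left \<omega>_pow_left \<omega>_self)
    ultimately show ?thesis by (simp add: field_simps)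
  qed
  have F': "F' (h \<otimes> g [^] a) = F h + a * \<alpha> + a / 2 * \<omega> h g" if "h \<in> H" for h and a :: int
    unfolding F'_def
  proof (rule the_equality)
    show "\<exists>h'\<in>H. \<exists>b :: int. h \<otimes> g [^] a = h' \<otimes> g [^] b \<and> F h + a * \<alpha> + a / 2 * \<omega> h g = F h' + of_int b * \<alpha> + of_int b / 2 * \<omega> h' g"
      by (rule bexI[OF exI[of _ a] that]) (rule conjI[OF refl refl])
  next
    fix r assume "\<exists>h'\<in>H. \<exists>b :: int. h \<otimes> g [^] a = h' \<otimes> g [^] b \<and> r = F h' + of_int b * \<alpha> + of_int b / 2 * \<omega> h' g"
    then obtain h' and b :: int where h': "h' \<in> H" "h \<otimes> g [^] a = h' \<otimes> g [^] b" "r = F h' + b * \<alpha> + b / 2 * \<omega> h' g"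
      by (elim bexE exE conjE)
    show "r = F h + a * \<alpha> + a / 2 * \<omega> h g"
      by (rule trans[OF h'(3) sym[OF wd[OF that h'(1,2)]]])
  qed
  have prod: "h \<otimes> g [^] a \<otimes> (h' \<otimes> g [^] b) = h \<otimes> h' \<otimes> com (g [^] a) h' \<otimes> g [^] (a + b)"
    if h: "h \<in> H" "h' \<in> H" for h h' and a b :: int
  proof -
    have "h \<otimes> g [^] a \<otimes> (h' \<otimes> g [^] b) = h \<otimes> (g [^] a \<otimes> h') \<otimes> g [^] b"
      using h by (simp add: m_assoc)
    also have "g [^] a \<otimes> h' = h' \<otimes> g [^] a \<otimes> com (g [^] a) h'" using h by (intro mult_swap) auto
    also have "h \<otimes> (h' \<otimes> g [^] a \<otimes> com (g [^] a) h') \<otimes> g [^] b =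
        h \<otimes> h' \<otimes> (g [^] a \<otimes> com (g [^] a) h') \<otimes> g [^] b"
      using h by (simp add: m_assoc)
    also have "g [^] a \<otimes> com (g [^] a) h' = com (g [^] a) h' \<otimes> g [^] a"
      using h by (intro central[symmetric] commutator_K) auto
    finally show ?thesis using h by (simp add: m_assoc int_pow_mult)
  qed
  have comH: "com (g [^] a) h \<in> H" if "h \<in> H" for h and a :: int
    using that KH commutator_K by auto
  have HH': "H \<subseteq> H'" unfolding H'_def by (force intro: exI[of _ "0 :: int"])
  have sub: "subgroup H' G"
  proof (rule subgroupI)
    show "H' \<subseteq> carrier G" by (auto simp: H'_def)
    show "H' \<noteq> {}" using HH' H.one_closed by blast
  next
    fix x assume "x \<in> H'"
    then obtain h and a :: int where x: "x = h \<otimes> g [^] a" "h \<in> H" by (auto simp: H'_def)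
    \<comment> \<open>The factors of the inverse come in the wrong order, so it is written as a
      product of two elements in normal form, to which \<open>prod\<close> applies.\<close>
    have "inv x = \<one> \<otimes> g [^] (- a) \<otimes> (inv h \<otimes> g [^] (0 :: int))"
      using x by (simp add: inv_mult_group int_pow_neg)
    also have "\<dots> \<in> H'"
      unfolding H'_def using prod[of \<one> "inv h" "- a" 0] x(2) comH[of "inv h" "- a"]
      by (intro CollectI exI[of _ "\<one> \<otimes> inv h \<otimes> com (g [^] (- a)) (inv h)"] exI[of _ "- a"]) auto
    finally show "inv x \<in> H'" .
  next
    fix x y assume "x \<in> H'" "y \<in> H'"
    then obtain h h' and a b :: int where x: "x = h \<otimes> g [^] a" "h \<in> H" and y: "y = h' \<otimes> g [^] b" "h' \<in> H"
      by (auto simp: H'_def)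
    show "x \<otimes> y \<in> H'"
      unfolding H'_def using prod[of h h' a b] x y comH[of h' a]
      by (intro CollectI exI[of _ "h \<otimes> h' \<otimes> com (g [^] a) h'"] exI[of _ "a + b"]) auto
  qed
  have "quadratic_on H' F'"
    unfolding quadratic_on_def
  proof (intro conjI ballI)
    fix z assume z: "z \<in> K"
    then show "F' z = q z"
      using F'[of z 0] KH quadratic_on_central[OF F] by auto
  next
    fix x y assume "x \<in> H'" "y \<in> H'"
    then obtain h h' and a b :: int where x: "x = h \<otimes> g [^] a" "h \<in> H" and y: "y = h' \<otimes> g [^] b" "h' \<in> H"
      by (auto simp: H'_def)
    note [simp] = x(2) y(2)
    let ?c = "com (g [^] a) h'"
    have K: "?c \<in> K" by (simp add: commutator_K)
    have "F (h \<otimes> h' \<otimes> ?c) = F h + F h' + \<omega> h h' / 2 + a * \<omega> g h'"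
    proof -
      have "F (h \<otimes> h' \<otimes> ?c) = F (h \<otimes> h') + F ?c + \<omega> (h \<otimes> h') ?c / 2"
        by (rule quadratic_on_mult[OF F]) (auto simp: comH)
      also have "\<omega> (h \<otimes> h') ?c = 0" using K by (intro \<omega>_central_right) auto
      also have "F ?c = a * \<omega> g h'"
        using quadratic_on_central[OF F K] \<omega>_pow_left[of g h' a] by (simp add: \<omega>_def)
      finally show ?thesis using quadratic_on_mult[OF F, of h h'] by simp
    qed
    moreover have "\<omega> (h \<otimes> h' \<otimes> ?c) g = \<omega> h g + \<omega> h' g"
      using K by (simp add: \<omega>_mult_left \<omega>_central)
    moreover have "\<omega> x y = \<omega> h h' + b * \<omega> h g + a * \<omega> g h'"
      unfolding x y by (simp add: \<omega>_mult_left \<omega>_mult_right \<omega>_pow_left \<omega>_pow_right \<omega>_self)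
    \<comment> \<open>Antisymmetry merges the commutator contribution
      \<open>a * \<omega> g h'\<close> with \<open>a / 2 * \<omega> h' g\<close> into
      \<open>a / 2 * \<omega> g h'\<close>, which is the last term of
      \<open>\<omega> x y / 2\<close>.\<close>
    moreover have "\<omega> g h' = - \<omega> h' g" by (rule \<omega>_swap) auto
    moreover have "x \<otimes> y = h \<otimes> h' \<otimes> ?c \<otimes> g [^] (a + b)"
      unfolding x(1) y(1) by (rule prod) auto
    moreover have "F' (h \<otimes> h' \<otimes> ?c \<otimes> g [^] (a + b)) = F (h \<otimes> h' \<otimes> ?c)
        + (a + b) * \<alpha> + (a + b) / 2 * \<omega> (h \<otimes> h' \<otimes> ?c) g"
      using F'[of "h \<otimes> h' \<otimes> ?c" "a + b"] comH[of h' a] by simp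
    moreover have "F' x = F h + a * \<alpha> + a / 2 * \<omega> h g" "F' y = F h' + b * \<alpha> + b / 2 * \<omega> h' g"
      unfolding x(1) y(1) by (rule F', simp)+
    ultimately show "F' (x \<otimes> y) = F' x + F' y + \<omega> x y / 2"
      by (simp add: algebra_simps add_divide_distrib)
  qed
  moreover have "g \<in> H'"
    unfolding H'_def by (intro CollectI exI[of _ \<one>] exI[of _ "1 :: int"]) auto
  ultimately show ?thesis using sub HH' by blast
qed

text \<open>On \<open>K\<close> the form vanishes, so \<open>q\<close> itself is a valid start; the
  finitely many generators are then adjoined one at a time.\<close>

lemma quadratic_exists:
  assumes "finite S" "S \<subseteq> carrier G" "generate G S = carrier G"
  shows "\<exists>F. quadratic_on (carrier G) F"
proof -
  from assms(1,2) have "\<exists>H F. subgroup H G \<and> K \<subseteq> H \<and> S \<subseteq> H \<and> quadratic_on H F"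
  proof (induction S rule: finite_induct)
    case empty
    have "quadratic_on K q"
      by (auto simp: quadratic_on_def q_mult \<omega>_central)
    then show ?case using K by blast
  next
    case (insert s S)
    then obtain H F where H: "subgroup H G" "K \<subseteq> H" "S \<subseteq> H" "quadratic_on H F" by auto
    obtain H' F' where "subgroup H' G" "H \<subseteq> H'" "s \<in> H'" "quadratic_on H' F'"
      using quadratic_extend[OF H(4,1,2), of s] insert.prems by auto
    then show ?case using H by (intro exI[of _ H'] exI[of _ F']) auto
  qed
  then obtain H F where H: "subgroup H G" "S \<subseteq> H" "quadratic_on H F" by blast
  have "carrier G \<subseteq> H" using generate_subgroup_incl[OF H(2,1)] assms(3) by simp
  then have "H = carrier G" using subgroup.subset[OF H(1)] by blast
  then show ?thesis using H(3) by blast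
qed

end

section \<open>Growth of the form and of its quadratic extension in the word length\<close>

context central_functional begin

text \<open>By bi-additivity the form on words is a sum over pairs of letters, and there are only
  finitely many such pairs.\<close>

lemma \<omega>_word_bound:
  assumes S: "finite S" "S \<subseteq> carrier G"
  obtains c :: real where "c \<ge> 0"
    "\<And>u x. u \<in> words S \<Longrightarrow> x \<in> S \<times> UNIV \<Longrightarrow> \<bar>\<omega> (word_val G u) (letter_val G x)\<bar> \<le> c * length u"
    "\<And>u v. u \<in> words S \<Longrightarrow> v \<in> words S \<Longrightarrow> \<bar>\<omega> (word_val G u) (word_val G v)\<bar> \<le> c * length u * length v"
proof -
  let ?L = "S \<times> (UNIV :: bool set)"
  \<comment> \<open>A sum rather than a maximum, so that an empty generating set needs no separate
    treatment.\<close>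
  define c where "c = (\<Sum>x\<in>?L. \<Sum>y\<in>?L. \<bar>\<omega> (letter_val G x) (letter_val G y)\<bar>)"
  have "finite ?L" using S by simp
  then have letters: "\<bar>\<omega> (letter_val G x) (letter_val G y)\<bar> \<le> c" if "x \<in> ?L" "y \<in> ?L" for x y
  proof -
    have "\<bar>\<omega> (letter_val G x) (letter_val G y)\<bar> \<le> (\<Sum>y\<in>?L. \<bar>\<omega> (letter_val G x) (letter_val G y)\<bar>)"
      using \<open>finite ?L\<close> that(2) by (intro member_le_sum) auto
    also have "\<dots> \<le> c"
      unfolding c_def using \<open>finite ?L\<close> that(1)
      by (intro member_le_sum[where f = "\<lambda>x. \<Sum>y\<in>?L. \<bar>\<omega> (letter_val G x) (letter_val G y)\<bar>"]) (auto intro: sum_nonneg)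
    finally show ?thesis .
  qed
  have c: "c \<ge> 0" unfolding c_def by (intro sum_nonneg) auto
  have letter: "letter_val G x \<in> carrier G" if "x \<in> ?L" for x
    using that S by (auto simp: letter_val_def)
  have word_val_Cons: "word_val G (x # u) = letter_val G x \<otimes> word_val G u" for x u
    by (simp add: word_val_def)
  have word_val_Nil: "word_val G [] = \<one>" by (simp add: word_val_def)
  have closed: "word_val G u \<in> carrier G" if "u \<in> words S" for u
    using word_val_closed[OF is_group S(2) that] .
  have words_Cons: "x # u \<in> words S \<longleftrightarrow> x \<in> ?L \<and> u \<in> words S" for x u
    by (auto simp: words_def)
  have one: "\<bar>\<omega> (word_val G u) (letter_val G x)\<bar> \<le> c * length u" if "u \<in> words S" "x \<in> ?L" for u x
    using that(1)
  proof (induction u)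
    case (Cons y u)
    then have "\<bar>\<omega> (letter_val G y) (letter_val G x)\<bar> \<le> c" using that(2) letters by (simp add: words_Cons)
    with Cons show ?case
      using letter[of y] letter[OF that(2)] closed[of u]
      by (simp add: word_val_Cons words_Cons \<omega>_mult_left algebra_simps)
  qed (simp add: word_val_Nil \<omega>_one letter[OF that(2)])
  have two: "\<bar>\<omega> (word_val G u) (word_val G v)\<bar> \<le> c * length u * length v"
    if "u \<in> words S" "v \<in> words S" for u v
    using that(2)
  proof (induction v)
    case (Cons y v)
    then have "\<bar>\<omega> (word_val G u) (letter_val G y)\<bar> \<le> c * length u" using one that(1) by (simp add: words_Cons)
    with Cons show ?case
      using letter[of y] closed[OF that(1)] closed[of v]
      by (simp add: word_val_Cons words_Cons \<omega>_mult_right algebra_simps)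
  qed (simp add: word_val_Nil \<omega>_one closed[OF that(1)])
  show ?thesis using that[OF c one two] .
qed

text \<open>Prefixing a letter changes \<open>F\<close> by a bounded amount plus half of a form
  value that is linear in the length; these increments add up to a quadratic bound.\<close>

lemma quadratic_word_bound:
  assumes S: "finite S" "S \<subseteq> carrier G" and F: "quadratic_on (carrier G) F"
  obtains c :: real where "c \<ge> 0" "\<And>u. u \<in> words S \<Longrightarrow> \<bar>F (word_val G u)\<bar> \<le> c * (length u)\<^sup>2"
proof -
  obtain a :: real where a: "a \<ge> 0"
    "\<And>u v. u \<in> words S \<Longrightarrow> v \<in> words S \<Longrightarrow> \<bar>\<omega> (word_val G u) (word_val G v)\<bar> \<le> a * length u * length v"
    using \<omega>_word_bound[OF S] by metis
  define b where "b = (\<Sum>x\<in>S \<times> (UNIV :: bool set). \<bar>F (letter_val G x)\<bar>)"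
  have b: "\<bar>F (letter_val G x)\<bar> \<le> b" if "x \<in> S \<times> UNIV" for x
    unfolding b_def using S that by (intro member_le_sum) auto
  have b0: "b \<ge> 0" unfolding b_def by (intro sum_nonneg) auto
  have "\<bar>F (word_val G u)\<bar> \<le> (a + b) * (length u)\<^sup>2" if "u \<in> words S" for u
    using that
  proof (induction u)
    case Nil
    then show ?case using quadratic_on_one[OF F] by (simp add: word_val_def)
  next
    case (Cons x u)
    then have x: "x \<in> S \<times> UNIV" "[x] \<in> words S" and u: "u \<in> words S" by (auto simp: words_def)
    have lv: "letter_val G x \<in> carrier G" using x(1) S by (auto simp: letter_val_def)
    then have "\<bar>\<omega> (letter_val G x) (word_val G u)\<bar> \<le> a * length u"
      using a(2)[OF x(2) u] by (simp add: word_val_def)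
    moreover have "F (word_val G (x # u)) = F (letter_val G x) + F (word_val G u) + \<omega> (letter_val G x) (word_val G u) / 2"
      using quadratic_on_mult[OF F lv word_val_closed[OF is_group S(2) u]] by (simp add: word_val_def)
    moreover have "\<bar>F (word_val G u)\<bar> \<le> (a + b) * (length u)\<^sup>2" using Cons u by blast
    moreover have "(a + b) * (length (x # u))\<^sup>2 = (a + b) * (length u)\<^sup>2 + 2 * (a * length u) + 2 * (b * length u) + a + b"
      by (simp add: power2_eq_square algebra_simps)
    moreover have "a * length u \<ge> 0" "b * length u \<ge> 0" using a(1) b0 by simp_all
    ultimately show ?case using b[OF x(1)] a(1) by (simp add: abs_le_iff; linarith)
  qed
  then show ?thesis using that[of "a + b"] a(1) b0 by simp
qed

text \<open>These are the coefficient and right hand side estimates for the linear equation. The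
  second holds because \<open>F\<close> agrees with \<open>q\<close> on \<open>K\<close> and splits
  over \<open>inv (word_val G u)\<close> and \<open>word_val G v\<close>, leaving two quadratic
  terms and one bilinear term.\<close>

lemma distortion_bound:
  assumes S: "finite S" "S \<subseteq> carrier G" "generate G S = carrier G"
  shows "\<exists>C::nat. \<forall>u\<in>words S.
    (\<forall>x\<in>S \<times> UNIV. \<bar>q (com (word_val G u) (letter_val G x))\<bar> \<le> C * length u) \<and>
    (\<forall>v\<in>words S. inv (word_val G u) \<otimes> word_val G v \<in> K \<longrightarrow>
       \<bar>q (inv (word_val G u) \<otimes> word_val G v)\<bar> \<le> C * (length u + length v)\<^sup>2)"
proof -
  obtain F where F: "quadratic_on (carrier G) F" using quadratic_exists[OF S] by blast
  obtain a :: real where a: "a \<ge> 0"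
    "\<And>u x. u \<in> words S \<Longrightarrow> x \<in> S \<times> UNIV \<Longrightarrow> \<bar>\<omega> (word_val G u) (letter_val G x)\<bar> \<le> a * length u"
    "\<And>u v. u \<in> words S \<Longrightarrow> v \<in> words S \<Longrightarrow> \<bar>\<omega> (word_val G u) (word_val G v)\<bar> \<le> a * length u * length v"
    using \<omega>_word_bound[OF S(1,2)] by metis
  obtain b :: real where b: "b \<ge> 0" "\<And>u. u \<in> words S \<Longrightarrow> \<bar>F (word_val G u)\<bar> \<le> b * (length u)\<^sup>2"
    using quadratic_word_bound[OF S(1,2) F] by metis
  define C where "C = nat \<lceil>a + b\<rceil>"
  have C: "a + b \<le> C" unfolding C_def by linarith
  show ?thesis
  proof (intro exI[of _ C] ballI conjI impI)
    fix u x assume "u \<in> words S" "x \<in> S \<times> (UNIV :: bool set)"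
    then have "\<bar>q (com (word_val G u) (letter_val G x))\<bar> \<le> a * length u"
      using a(2) by (simp add: \<omega>_def)
    also have "\<dots> \<le> real C * real (length u)" using C b(1) by (intro mult_right_mono) auto
    finally show "\<bar>q (com (word_val G u) (letter_val G x))\<bar> \<le> C * length u" by simp
  next
    fix u v assume u: "u \<in> words S" and v: "v \<in> words S"
      and K: "inv (word_val G u) \<otimes> word_val G v \<in> K"
    have [simp]: "word_val G u \<in> carrier G" "word_val G v \<in> carrier G"
      using word_val_closed[OF is_group S(2)] u v by auto
    have "q (inv (word_val G u) \<otimes> word_val G v) = F (inv (word_val G u) \<otimes> word_val G v)"
      using quadratic_on_central[OF F K] by simp
    also have "\<dots> = F (word_val G v) - F (word_val G u) - \<omega> (word_val G u) (word_val G v) / 2"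
      using quadratic_on_mult[OF F, of "inv (word_val G u)" "word_val G v"]
        quadratic_on_inv[OF F subgroup_self, of "word_val G u"] by (simp add: \<omega>_inv)
    finally have "\<bar>q (inv (word_val G u) \<otimes> word_val G v)\<bar>
        \<le> b * (length u)\<^sup>2 + b * (length v)\<^sup>2 + a * (length u * length v) / 2"
      using a(3)[OF u v] b(2)[OF u] b(2)[OF v] by (simp add: mult.assoc abs_le_iff; linarith)
    also have "\<dots> \<le> (a + b) * (length u + length v)\<^sup>2"
    proof -
      have "(a + b) * (length u + length v)\<^sup>2 = b * (length u)\<^sup>2 + b * (length v)\<^sup>2 + 2 * (a * (length u * length v))
          + (2 * (b * (length u * length v)) + a * (length u)\<^sup>2 + a * (length v)\<^sup>2)"
        by (simp add: power2_eq_square algebra_simps)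
      moreover have "a * (length u * length v) \<ge> 0" "b * (length u * length v) \<ge> 0"
        "a * (length u)\<^sup>2 \<ge> 0" "a * (length v)\<^sup>2 \<ge> 0" using a(1) b(1) by simp_all
      ultimately show ?thesis by linarith
    qed
    also have "\<dots> \<le> real C * (length u + length v)\<^sup>2" using C by (intro mult_right_mono) auto
    finally show "\<bar>q (inv (word_val G u) \<otimes> word_val G v)\<bar> \<le> C * (length u + length v)\<^sup>2" by simp
  qed
qed

end

section \<open>Minimal solutions of linear equations\<close>

text \<open>The map \<open>\<Phi>\<close> is kept abstract so that torsion, which the coordinates
  \<open>q j\<close> do not see, enters only through the box count \<open>\<beta>\<close>. The
  assumption \<open>add\<close> stands in for the group law of the target when a piece of a solution
  is exchanged.\<close>

lemma minimal_weight_bound: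
  fixes \<Phi> :: "('l \<Rightarrow> nat) \<Rightarrow> 'h" and q \<gamma> :: "'j \<Rightarrow> _ \<Rightarrow> int" and N :: int and n \<beta> :: nat
  assumes L: "finite L" and n: "n > 0"
    and coord: "\<And>y j. j \<in> J \<Longrightarrow> q j (\<Phi> y) = (\<Sum>l\<in>L. int (y l) * \<gamma> j l)"
    and step: "\<And>j l. j \<in> J \<Longrightarrow> l \<in> L \<Longrightarrow> \<bar>\<gamma> j l\<bar> \<le> N"
    and target: "\<And>j. j \<in> J \<Longrightarrow> \<bar>q j (\<Phi> x)\<bar> \<le> N * int n"
    and add: "\<And>y y' d. \<Phi> y = \<Phi> y' \<Longrightarrow> \<Phi> (\<lambda>l. y l + d l) = \<Phi> (\<lambda>l. y' l + d l)"
    and range: "\<And>y. \<Phi> y \<in> H"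
    and fin: "\<And>a. finite {h \<in> H. \<forall>j\<in>J. q j h \<in> {a j..a j + (2 * (int (card L) + 1) * N + 1)}}"
    and card: "\<And>a. card {h \<in> H. \<forall>j\<in>J. q j h \<in> {a j..a j + (2 * (int (card L) + 1) * N + 1)}} \<le> \<beta>"
    and minimal: "\<And>y. \<Phi> y = \<Phi> x \<Longrightarrow> sum x L \<le> sum y L"
  shows "sum x L \<le> card L * ((n + 1) * \<beta>)"
proof (cases "\<forall>l\<in>L. x l = 0")
  case True
  then show ?thesis by simp
next
  case False
  define M where "M = Max (x ` L)"
  have le_M: "x l \<le> M" if "l \<in> L" for l
    using L that by (simp add: M_def)
  have "M \<in> x ` L" using L False by (auto simp: M_def intro!: Max_in)
  then obtain l0 where l0: "l0 \<in> L" "x l0 = M" by auto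
  have M: "M > 0" using False le_M by fastforce
  define f where "f t l = t * x l div M" for t l
  have f_le: "f t l \<le> x l" if "t \<le> M" for t l
  proof -
    have "t * x l div M \<le> M * x l div M" using that by (intro div_le_mono mult_right_mono) auto
    then show ?thesis using M by (simp add: f_def)
  qed
  have inj: "inj_on (\<lambda>t. \<Phi> (f t)) {0..M}"
  proof (rule linorder_inj_onI)
    fix s t assume st: "s < t" "s \<in> {0..M}" "t \<in> {0..M}"
    show "\<Phi> (f s) \<noteq> \<Phi> (f t)"
    proof
      assume eq: "\<Phi> (f s) = \<Phi> (f t)"
      \<comment> \<open>Cuts the piece between \<open>f s\<close> and \<open>f t\<close> out of
        \<open>x\<close>. The natural subtraction is exact because
        \<open>f t l \<le> x l\<close>.\<close>
      define y where "y l = f s l + (x l - f t l)" for l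
      have x: "(\<lambda>l. f t l + (x l - f t l)) = x"
        using f_le[of t] st by auto
      have "\<Phi> y = \<Phi> x"
        using add[OF eq, of "\<lambda>l. x l - f t l"] x by (simp add: y_def[abs_def])
      then have "sum x L \<le> sum y L" by (rule minimal)
      moreover have "sum y L < sum x L"
      proof (rule sum_strict_mono_ex1[OF L])
        have "f s l \<le> f t l" for l
          using st by (auto simp: f_def intro!: div_le_mono mult_right_mono)
        moreover have "f t l \<le> x l" for l
          using f_le st by simp
        ultimately have "y l \<le> x l" for l
          unfolding y_def using le_diff_conv2 by (metis add.commute le_add_diff_inverse nat_add_left_cancel_le)
        then show "\<forall>l\<in>L. y l \<le> x l" by blast
        \<comment> \<open>No rounding occurs at a letter of maximal multiplicity, so the piece cut
          out has multiplicity \<open>t - s > 0\<close> there.\<close>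
        have "f s l0 = s" "f t l0 = t" using l0 M by (auto simp: f_def)
        then have "y l0 < x l0" using st l0 by (simp add: y_def)
        then show "\<exists>l\<in>L. y l < x l" using l0 by blast
      qed
      ultimately show False by simp
    qed
  qed auto
  define k where "k = int (card L)"
  \<comment> \<open>The margin on each side is \<open>(k + 1) * N\<close>: \<open>k * N\<close> for
    rounding the multiplicities of \<open>k\<close> letters and \<open>N\<close> for rounding
    \<open>t / M\<close> to a multiple of \<open>1 / n\<close>. The extra 1 absorbs the integer
    division in the centre of the box.\<close>
  define R where "R = 2 * (k + 1) * N + 1"
  define b where "b j = q j (\<Phi> x)" for j
  define a where "a i j = int i * b j div int n - (k + 1) * N" for i j
  \<comment> \<open>the boxes are centred at the points \<open>i b / n\<close> of the segment from \<open>0\<close> to \<open>b\<close>\<close>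
  define box where "box i = {h \<in> H. \<forall>j\<in>J. q j h \<in> {a i j..a i j + R}}" for i
  have sub: "(\<lambda>t. \<Phi> (f t)) ` {0..M} \<subseteq> (\<Union>i\<in>{..n}. box i)"
  proof clarsimp
    fix t assume t: "t \<le> M"
    \<comment> \<open>The box is chosen so that \<open>i / n\<close> is the largest multiple of
      \<open>1 / n\<close> not exceeding \<open>t / M\<close>.\<close>
    define i where "i = t * n div M"
    have "t * n div M \<le> M * n div M" using t by (intro div_le_mono mult_right_mono) auto
    then have i: "i \<le> n" using M by (simp add: i_def)
    have "\<Phi> (f t) \<in> box i"
      unfolding box_def
    proof (intro CollectI conjI ballI range)
      fix j assume j: "j \<in> J"
      let ?p = "q j (\<Phi> (f t))"
      \<comment> \<open>Multiplying by \<open>M\<close> turns the floors into remainders, each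
        smaller than \<open>M\<close>.\<close>
      have "int M * ?p = (\<Sum>l\<in>L. int (M * f t l) * \<gamma> j l)"
        by (simp add: coord[OF j] sum_distrib_left mult.assoc)
      also have "\<dots> = (\<Sum>l\<in>L. int t * (int (x l) * \<gamma> j l) - int (t * x l mod M) * \<gamma> j l)"
      proof (rule sum.cong[OF refl])
        fix l
        have "M * f t l + t * x l mod M = t * x l"
          by (simp add: f_def)
        then have "int (M * f t l) = int t * int (x l) - int (t * x l mod M)"
          by (metis add_diff_cancel_right' of_nat_add of_nat_mult)
        then show "int (M * f t l) * \<gamma> j l = int t * (int (x l) * \<gamma> j l) - int (t * x l mod M) * \<gamma> j l"
          by (simp only: left_diff_distrib mult.assoc)
      qed
      also have "\<dots> = int t * b j - (\<Sum>l\<in>L. int (t * x l mod M) * \<gamma> j l)"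
        by (simp add: sum_subtractf b_def coord[OF j] sum_distrib_left)
      finally have p: "int t * b j - int M * ?p = (\<Sum>l\<in>L. int (t * x l mod M) * \<gamma> j l)"
        by simp
      have "\<bar>\<Sum>l\<in>L. int (t * x l mod M) * \<gamma> j l\<bar> \<le> (\<Sum>l\<in>L. int M * N)"
      proof (rule order.trans[OF sum_abs sum_mono])
        fix l assume "l \<in> L"
        have "t * x l mod M < M" using M by simp
        then have "int (t * x l mod M) \<le> int M" by linarith
        then show "\<bar>int (t * x l mod M) * \<gamma> j l\<bar> \<le> int M * N"
          unfolding abs_mult using step[OF j \<open>l \<in> L\<close>] by (intro mult_mono) auto
      qed
      then have d1: "\<bar>int t * b j - int M * ?p\<bar> \<le> int M * (k * N)"
        unfolding p k_def by (simp add: algebra_simps)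
      define r where "r = t * n mod M"
      have r: "r < M" using M by (simp add: r_def)
      have "t * n = M * i + r" by (simp add: i_def r_def)
      then have tn: "int t * int n = int M * int i + int r" by (metis of_nat_add of_nat_mult)
      have b: "\<bar>b j\<bar> \<le> N * int n" using target[OF j] by (simp add: b_def)
      \<comment> \<open>Passes from \<open>t / M\<close> to \<open>i / n\<close>. They differ by
        \<open>r / (M * n) < 1 / n\<close>, and \<open>\<bar>b j\<bar> \<le> N * n\<close>, so the
        point on the segment moves by at most \<open>N\<close>.\<close>
      have "int n * (int M * ?p) - int M * (int i * b j)
          = int r * b j - int n * (int t * b j - int M * ?p)"
      proof -
        have "int n * (int t * b j) = int M * (int i * b j) + int r * b j"
          using arg_cong[OF tn, of "\<lambda>z. z * b j"] by (simp add: algebra_simps)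
        then show ?thesis by (simp add: algebra_simps)
      qed
      moreover have "\<bar>int r * b j\<bar> \<le> int M * (N * int n)"
        unfolding abs_mult using r b by (intro mult_mono) auto
      moreover have "\<bar>int n * (int t * b j - int M * ?p)\<bar> \<le> int n * (int M * (k * N))"
        unfolding abs_mult using d1 by (intro mult_mono) auto
      ultimately have "\<bar>int n * (int M * ?p) - int M * (int i * b j)\<bar>
          \<le> int M * (N * int n) + int n * (int M * (k * N))" by linarith
      moreover have "int n * (int M * ?p) - int M * (int i * b j) = int M * (int n * ?p - int i * b j)"
        by (simp add: algebra_simps)
      moreover have "int M * (N * int n) + int n * (int M * (k * N)) = int M * (int n * ((k + 1) * N))"
        by (simp add: algebra_simps)
      ultimately have "int M * \<bar>int n * ?p - int i * b j\<bar> \<le> int M * (int n * ((k + 1) * N))"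
        by (simp add: abs_mult)
      then have d2: "\<bar>int n * ?p - int i * b j\<bar> \<le> int n * ((k + 1) * N)"
        using M by simp
      define e where "e = int i * b j div int n"
      have e: "int i * b j = int n * e + int i * b j mod int n" by (simp add: e_def)
      have "0 \<le> int i * b j mod int n" "int i * b j mod int n < int n" using n by auto
      then have "int n * (?p - e) < int n * ((k + 1) * N + 1)" "int n * (-((k + 1) * N)) \<le> int n * (?p - e)"
        using d2 e by (simp_all add: algebra_simps abs_le_iff)
      then have "?p - e < (k + 1) * N + 1" "?p - e \<ge> -((k + 1) * N)"
        using n by (simp_all only: mult_less_cancel_left_pos mult_le_cancel_left_pos of_nat_0_less_iff)
      then show "?p \<in> {a i j..a i j + R}"
        by (simp add: a_def R_def e_def algebra_simps)
    qed
    with i show "\<exists>i\<in>{..n}. \<Phi> (f t) \<in> box i" by blast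
  qed
  have fin_box: "finite (box i)" and card_box: "card (box i) \<le> \<beta>" for i
    using fin[of "a i"] card[of "a i"] by (auto simp: box_def R_def k_def)
  have "M + 1 = card ((\<lambda>t. \<Phi> (f t)) ` {0..M})" using inj by (simp add: card_image)
  also have "\<dots> \<le> card (\<Union>i\<in>{..n}. box i)" using fin_box by (intro card_mono sub) auto
  also have "\<dots> \<le> (\<Sum>i\<in>{..n}. card (box i))" by (rule card_UN_le) simp
  also have "\<dots> \<le> (n + 1) * \<beta>" using sum_mono[of "{..n}" "\<lambda>i. card (box i)" "\<lambda>_. \<beta>"] card_box by simp
  finally have "M \<le> (n + 1) * \<beta>" by simp
  moreover have "sum x L \<le> card L * M" using sum_bounded_above[of L x M] le_M by simp
  ultimately show ?thesis by (meson le_trans mult_le_mono2)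
qed

section \<open>Products with prescribed multiplicities in an abelian group\<close>

context comm_group
begin

text \<open>Natural exponents suffice because a generator and its inverse count as two letters, and
  the sum of the multiplicities is then the word length.\<close>

definition weight_prod :: "('l \<Rightarrow> 'a) \<Rightarrow> 'l set \<Rightarrow> ('l \<Rightarrow> nat) \<Rightarrow> 'a" where
  "weight_prod c L y = finprod G (\<lambda>l. c l [^] y l) L"

lemma weight_prod_closed [simp]: "c \<in> L \<rightarrow> carrier G \<Longrightarrow> weight_prod c L y \<in> carrier G"
  unfolding weight_prod_def by (intro finprod_closed) auto

lemma weight_prod_add:
  assumes "c \<in> L \<rightarrow> carrier G"
  shows "weight_prod c L (\<lambda>l. y l + d l) = weight_prod c L y \<otimes> weight_prod c L d"
proof -
  have "weight_prod c L (\<lambda>l. y l + d l) = finprod G (\<lambda>l. c l [^] y l \<otimes> c l [^] d l) L"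
    unfolding weight_prod_def using assms by (intro finprod_cong') (auto simp: nat_pow_mult Pi_iff)
  then show ?thesis
    unfolding weight_prod_def using assms by (subst (asm) finprod_multf) auto
qed

lemma weight_prod_cong:
  assumes "c \<in> L \<rightarrow> carrier G" "\<And>l. l \<in> L \<Longrightarrow> y l = y' l"
  shows "weight_prod c L y = weight_prod c L y'"
  unfolding weight_prod_def using assms by (intro finprod_cong') auto

lemma weight_prod_single:
  assumes c: "c \<in> L \<rightarrow> carrier G" and L: "finite L" "l \<in> L"
  shows "weight_prod c L (\<lambda>x. if x = l then 1 else 0) = c l"
proof -
  have "weight_prod c L (\<lambda>x. if x = l then 1 else 0) = (\<Otimes>x\<in>L. if l = x then c x else \<one>)"
    unfolding weight_prod_def using c by (intro finprod_cong') (auto simp: Pi_iff)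
  also have "\<dots> = c l" using c L by (intro finprod_singleton) auto
  finally show ?thesis .
qed

lemma additive_weight_prod:
  fixes h :: "'a \<Rightarrow> int"
  assumes L: "finite L" and c: "c \<in> L \<rightarrow> carrier G"
    and h: "\<And>a b. a \<in> carrier G \<Longrightarrow> b \<in> carrier G \<Longrightarrow> h (a \<otimes> b) = h a + h b"
  shows "h (weight_prod c L y) = (\<Sum>l\<in>L. int (y l) * h (c l))"
proof -
  have one: "h \<one> = 0" using h[of \<one> \<one>] by simp
  have pow: "h (a [^] k) = int k * h a" if "a \<in> carrier G" for a and k :: nat
    using that by (induction k) (auto simp: one h algebra_simps)
  show ?thesis
    unfolding weight_prod_def using L c
  proof (induction L rule: finite_induct)
    case (insert l L)
    then have "(\<lambda>l. c l [^] y l) \<in> L \<rightarrow> carrier G" "c l [^] y l \<in> carrier G" by auto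
    then show ?case using insert by (simp add: h pow)
  qed (simp add: one)
qed

end

text \<open>Realises a vector of multiplicities by a word, so that a shortest word gives a vector of
  least weight.\<close>

lemma ex_list_count:
  assumes "finite L"
  shows "\<exists>w. set w \<subseteq> L \<and> (\<forall>l\<in>L. count_list w l = y l)"
  using assms
proof (induction L rule: finite_induct)
  case (insert a L)
  then obtain w where w: "set w \<subseteq> L" "\<forall>l\<in>L. count_list w l = y l" by blast
  have "count_list (replicate k a) l = (if l = a then k else 0)" for k l
    by (induction k) auto
  moreover have "count_list w a = 0" using w(1) insert.hyps by (auto simp: count_list_0_iff)
  ultimately show ?case
    using w insert.hyps by (intro exI[of _ "replicate (y a) a @ w"]) auto
qed simp

section \<open>The conjugator length function\<close>

text \<open>Since \<open>com a\<close> is multiplicative in its second argument, this is the linear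
  equation for the conjugator.\<close>

lemma (in central_commutators) conjugate_iff_com:
  assumes [simp]: "a \<in> carrier G" "b \<in> carrier G" "g \<in> carrier G"
  shows "a \<otimes> g = g \<otimes> b \<longleftrightarrow> com a g = inv a \<otimes> b"
proof
  assume "a \<otimes> g = g \<otimes> b"
  then have "g \<otimes> (a \<otimes> com a g) = g \<otimes> b" using mult_swap[of a g] by (simp add: m_assoc)
  then have "a \<otimes> com a g = b" by simp
  then show "com a g = inv a \<otimes> b" by (metis assms(1-3) com_closed inv_solve_left)
next
  assume "com a g = inv a \<otimes> b"
  then have "a \<otimes> com a g = b" by (simp add: m_assoc[symmetric])
  moreover have "a \<otimes> g = g \<otimes> (a \<otimes> com a g)" using mult_swap[of a g] by (simp add: m_assoc)
  ultimately show "a \<otimes> g = g \<otimes> b" by simp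
qed

text \<open>Here \<open>\<rho>\<close> embeds \<open>K\<close> into a group with \<open>m\<close>
  integer coordinates; the box count expresses that this group has rank at most \<open>m\<close>,
  with \<open>\<tau>\<close> accounting for torsion.\<close>

lemma (in central_commutators) CL_asymp_le:
  fixes Y :: "('y, 'd) monoid_scheme" and \<rho> :: "'g \<Rightarrow> 'y" and q :: "nat \<Rightarrow> 'y \<Rightarrow> int"
  assumes S: "finite S" "S \<subseteq> carrier G" "generate G S = carrier G"
    and Y: "comm_group Y"
    and \<rho>: "\<rho> \<in> K \<rightarrow> carrier Y" "\<And>z z'. z \<in> K \<Longrightarrow> z' \<in> K \<Longrightarrow> \<rho> (z \<otimes> z') = \<rho> z \<otimes>\<^bsub>Y\<^esub> \<rho> z'" "inj_on \<rho> K"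
    and q: "\<And>j a b. j < m \<Longrightarrow> a \<in> carrier Y \<Longrightarrow> b \<in> carrier Y \<Longrightarrow> q j (a \<otimes>\<^bsub>Y\<^esub> b) = q j a + q j b"
    and fin: "\<And>a R. finite {h \<in> carrier Y. \<forall>j\<in>{..<m}. q j h \<in> {a j..a j + int R}}"
    and card: "\<And>a R. card {h \<in> carrier Y. \<forall>j\<in>{..<m}. q j h \<in> {a j..a j + int R}} \<le> \<tau> * (R + 1) ^ m"
  shows "CL G S \<preceq> (\<lambda>n. n ^ (m + 1))"
proof -
  interpret Y: comm_group Y by fact
  define L where "L = S \<times> (UNIV :: bool set)"
  define k where "k = card L"
  have finL: "finite L" using S by (simp add: L_def)
  have words_L: "words S = {w. set w \<subseteq> L}" by (auto simp: words_def L_def)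
  have closed: "word_val G u \<in> carrier G" if "u \<in> words S" for u
    using word_val_closed[OF is_group S(2) that] .
  have letter: "letter_val G x \<in> carrier G" if "x \<in> L" for x
    using that S by (auto simp: letter_val_def L_def)
  have "\<exists>C::nat. \<forall>u\<in>words S.
      (\<forall>x\<in>L. \<bar>q j (\<rho> (com (word_val G u) (letter_val G x)))\<bar> \<le> int (C * length u)) \<and>
      (\<forall>v\<in>words S. inv (word_val G u) \<otimes> word_val G v \<in> K \<longrightarrow>
         \<bar>q j (\<rho> (inv (word_val G u) \<otimes> word_val G v))\<bar> \<le> int (C * (length u + length v)\<^sup>2))"
    if j: "j < m" for j
  proof -
    \<comment> \<open>Each integer coordinate of \<open>K\<close>, read as a real number, is a
      functional to which the distortion estimates apply.\<close>
    interpret central_functional G K "\<lambda>z. real_of_int (q j (\<rho> z))"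
      using j \<rho> q by unfold_locales (auto simp: Pi_iff)
    have conv: "\<bar>real_of_int z\<bar> \<le> real c \<longleftrightarrow> \<bar>z\<bar> \<le> int c" for z c by linarith
    show ?thesis
      using distortion_bound[OF S] unfolding conv L_def of_nat_mult[symmetric] of_nat_power[symmetric] of_nat_add[symmetric] .
  qed
  then obtain Cj :: "nat \<Rightarrow> nat" where Cj: "\<And>j u x. j < m \<Longrightarrow> u \<in> words S \<Longrightarrow> x \<in> L \<Longrightarrow>
      \<bar>q j (\<rho> (com (word_val G u) (letter_val G x)))\<bar> \<le> int (Cj j * length u)"
    "\<And>j u v. j < m \<Longrightarrow> u \<in> words S \<Longrightarrow> v \<in> words S \<Longrightarrow> inv (word_val G u) \<otimes> word_val G v \<in> K \<Longrightarrow>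
         \<bar>q j (\<rho> (inv (word_val G u) \<otimes> word_val G v))\<bar> \<le> int (Cj j * (length u + length v)\<^sup>2)"
    by metis
  define C where "C = (\<Sum>j<m. Cj j)"
  have C: "Cj j \<le> C" if "j < m" for j
    unfolding C_def using that by (intro member_le_sum) auto
  have pair: "CL_words G S u v \<le> k * ((n + 1 + 1) * (\<tau> * (2 * (k + 1) * (C * (n + 1)) + 2) ^ m))"
    if u: "u \<in> words S" and v: "v \<in> words S" and conj: "conj_words G u v" and n: "length u + length v \<le> n" for u v n
  proof -
    let ?u = "word_val G u" and ?v = "word_val G v"
    note [simp] = closed[OF u] closed[OF v]
    define c where "c x = \<rho> (com ?u (letter_val G x))" for x
    define \<Phi> where "\<Phi> = Y.weight_prod c L"
    have c: "c \<in> L \<rightarrow> carrier Y"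
      using \<rho>(1) by (auto simp: c_def intro!: commutator_K letter)
    have \<rho>_one: "\<rho> \<one> = \<one>\<^bsub>Y\<^esub>"
      using \<rho>(2)[of \<one> \<one>] \<rho>(1) subgroup.one_closed[OF K] by (auto simp: Pi_iff)
    have word_count: "\<rho> (com ?u (word_val G w)) = \<Phi> (count_list w)" if "w \<in> words S" for w
      using that
    proof (induction w)
      case Nil
      have "\<Phi> (\<lambda>_. 0) = \<one>\<^bsub>Y\<^esub>" by (simp add: \<Phi>_def Y.weight_prod_def)
      moreover have "com ?u \<one> = \<one>" by (rule com_eqI) auto
      ultimately show ?case by (simp add: word_val_def \<rho>_one count_list.simps(1)[abs_def])
    next
      case (Cons x w)
      then have x: "x \<in> L" and w: "w \<in> words S" by (auto simp: words_L)
      have "word_val G (x # w) = letter_val G x \<otimes> word_val G w" by (simp add: word_val_def)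
      then have "\<rho> (com ?u (word_val G (x # w))) = \<rho> (com ?u (letter_val G x) \<otimes> com ?u (word_val G w))"
        using letter[OF x] closed[OF w] by (simp add: com_mult_right)
      also have "\<dots> = \<Phi> (count_list w) \<otimes>\<^bsub>Y\<^esub> c x"
        using letter[OF x] closed[OF w] Cons.IH[OF w] c x
        by (simp add: \<rho>(2) commutator_K c_def[symmetric] \<Phi>_def Y.m_comm Pi_iff)
      also have "\<dots> = \<Phi> (\<lambda>l. count_list w l + (if l = x then 1 else 0))"
        unfolding \<Phi>_def Y.weight_prod_add[OF c] Y.weight_prod_single[OF c finL x] ..
      also have "(\<lambda>l. count_list w l + (if l = x then 1 else 0)) = count_list (x # w)"
        by auto
      finally show ?case .
    qed
    obtain w where w: "w \<in> words S" "length w = CL_words G S u v" "?u \<otimes> word_val G w = word_val G w \<otimes> ?v"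
      using CL_words_witness[OF is_group S(2,3) u v conj] by blast
    have com_w: "com ?u (word_val G w) = inv ?u \<otimes> ?v"
      using w(3) conjugate_iff_com[of ?u ?v "word_val G w"] closed[OF w(1)] by simp
    have inK: "inv ?u \<otimes> ?v \<in> K"
      using commutator_K[of ?u "word_val G w"] closed[OF w(1)] com_w by simp
    have len_count: "length w' = sum (count_list w') L" if "w' \<in> words S" for w'
      using sum_count_set[of w' L] that finL by (simp add: words_L)
    \<comment> \<open>The shift to \<open>n + 1\<close> supplies the positive number of subdivisions
      that \<open>minimal_weight_bound\<close> requires, and \<open>N * (n + 1)\<close> dominates
      the quadratic bound on the right hand side.\<close>
    define N where "N = C * (n + 1)"
    define R where "R = 2 * (k + 1) * N + 1"
    have R: "2 * (int (card L) + 1) * int N + 1 = int R" by (simp add: R_def k_def algebra_simps)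
    have \<Phi>w: "\<Phi> (count_list w) = \<rho> (inv ?u \<otimes> ?v)" using word_count[OF w(1)] com_w by simp
    have "sum (count_list w) L \<le> card L * ((n + 1 + 1) * (\<tau> * (R + 1) ^ m))"
    proof (rule minimal_weight_bound[where J = "{..<m}" and H = "carrier Y" and \<Phi> = \<Phi> and N = "int N"
          and q = q and \<gamma> = "\<lambda>j l. q j (c l)" and n = "n + 1"])
      fix y and j :: nat assume "j \<in> {..<m}"
      then show "q j (\<Phi> y) = (\<Sum>l\<in>L. int (y l) * q j (c l))"
        unfolding \<Phi>_def using q by (intro Y.additive_weight_prod finL c) auto
    next
      fix j :: nat and l assume j: "j \<in> {..<m}" and l: "l \<in> L"
      have "\<bar>q j (c l)\<bar> \<le> int (Cj j * length u)" unfolding c_def using Cj(1)[OF _ u l] j by simp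
      moreover have "int (Cj j * length u) \<le> int N"
        unfolding N_def of_nat_le_iff using C j n by (intro mult_le_mono) auto
      ultimately show "\<bar>q j (c l)\<bar> \<le> int N" by (rule order.trans)
    next
      fix j :: nat assume j: "j \<in> {..<m}"
      have "\<bar>q j (\<Phi> (count_list w))\<bar> \<le> int (Cj j * (length u + length v)\<^sup>2)"
        unfolding \<Phi>w using Cj(2)[OF _ u v inK] j by simp
      moreover have "int (Cj j * (length u + length v)\<^sup>2) \<le> int (C * (n + 1)\<^sup>2)"
        unfolding of_nat_le_iff using C j n by (intro mult_le_mono power_mono) auto
      moreover have "int (C * (n + 1)\<^sup>2) = int N * int (n + 1)" by (simp add: N_def power2_eq_square algebra_simps)
      ultimately show "\<bar>q j (\<Phi> (count_list w))\<bar> \<le> int N * int (n + 1)" by linarith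
    next
      fix y y' d assume "\<Phi> y = \<Phi> y'"
      then show "\<Phi> (\<lambda>l. y l + d l) = \<Phi> (\<lambda>l. y' l + d l)"
        unfolding \<Phi>_def Y.weight_prod_add[OF c] by simp
    next
      fix y assume y: "\<Phi> y = \<Phi> (count_list w)"
      \<comment> \<open>A competing vector comes from a word, and injectivity of
        \<open>\<rho>\<close> on \<open>K\<close> makes that word a conjugator, so it is at least as
        long as \<open>w\<close>.\<close>
      obtain w' where w': "set w' \<subseteq> L" "\<forall>l\<in>L. count_list w' l = y l"
        using ex_list_count[OF finL] by blast
      then have w'S: "w' \<in> words S" by (simp add: words_L)
      have "\<Phi> (count_list w') = \<Phi> y"
        unfolding \<Phi>_def using w'(2) by (intro Y.weight_prod_cong c) auto
      then have "\<rho> (com ?u (word_val G w')) = \<rho> (com ?u (word_val G w))"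
        using word_count w'S w(1) y by simp
      then have "com ?u (word_val G w') = com ?u (word_val G w)"
        using \<rho>(3) closed[OF w'S] closed[OF w(1)] by (auto dest!: inj_onD intro: commutator_K)
      then have "?u \<otimes> word_val G w' = word_val G w' \<otimes> ?v"
        using conjugate_iff_com[of ?u ?v "word_val G w'"] com_w closed[OF w'S] by simp
      then have "CL_words G S u v \<le> length w'"
        unfolding CL_words_def using w'S by (intro Least_le) blast
      moreover have "sum (count_list w') L = sum y L" using w'(2) by (intro sum.cong) auto
      ultimately show "sum (count_list w) L \<le> sum y L"
        using len_count[OF w(1)] len_count[OF w'S] w(2) by simp
    qed (simp_all only: R fin card, use finL c in \<open>auto simp: \<Phi>_def\<close>)
    then show ?thesis
      using len_count[OF w(1)] w(2) by (simp add: R_def N_def k_def)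
  qed
  define D where "D = 2 * (k + 1) * C + 2"
  \<comment> \<open>The summand 1 makes \<open>E\<close> positive even if the product vanishes, and
    gives \<open>n + 1 \<le> E * n + E\<close>.\<close>
  define E where "E = k * 2 * \<tau> * D ^ m + 1"
  have "CL G S n \<le> E * (E * n + E) ^ (m + 1) + E" for n
  proof -
    have "CL G S n \<in> CL_set G S n"
      unfolding CL_def by (intro Max_in finite_CL_set CL_set_nonempty S is_group)
    then obtain u v where uv: "CL G S n = CL_words G S u v" "u \<in> words S" "v \<in> words S"
      "conj_words G u v" "length u + length v \<le> n"
      unfolding CL_set_def by blast
    have "CL G S n \<le> k * ((n + 1 + 1) * (\<tau> * (2 * (k + 1) * (C * (n + 1)) + 2) ^ m))"
      unfolding uv(1) by (rule pair[OF uv(2-5)])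
    \<comment> \<open>The number of boxes contributes one factor \<open>n + 1\<close> and the size
      of a box contributes \<open>m\<close> of them.\<close>
    also have "\<dots> \<le> k * (2 * (n + 1) * (\<tau> * (D * (n + 1)) ^ m))"
      by (intro mult_le_mono power_mono) (auto simp: D_def algebra_simps)
    also have "\<dots> = k * 2 * \<tau> * D ^ m * (n + 1) ^ (m + 1)"
      by (simp only: power_mult_distrib power_add power_one_right mult_ac)
    also have "\<dots> \<le> E * (E * n + E) ^ (m + 1)"
    proof (intro mult_le_mono power_mono)
      show "k * 2 * \<tau> * D ^ m \<le> E" by (simp add: E_def)
      have "E \<ge> 1" by (simp add: E_def)
      then have "1 * (n + 1) \<le> E * (n + 1)" by (rule mult_right_mono) simp
      then show "n + 1 \<le> E * n + E" by (simp only: mult_1 distrib_left mult_1_right)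
    qed simp
    finally show ?thesis by simp
  qed
  moreover have "E > 0" by (simp add: E_def)
  ultimately show ?thesis unfolding asymp_le_def by blast
qed

section \<open>The target group: a free abelian group of rank \<open>m\<close> times a finite
  group\<close>

lemma comm_group_free_abelian_DirProd:
  assumes "comm_group T"
  shows "comm_group (free_abelian_rank m \<times>\<times> T)"
proof -
  interpret T: comm_group T by fact
  interpret I: comm_group integer_group by (rule abelian_integer_group)
  have F: "group (free_abelian_rank m)" by simp
  have "group (free_abelian_rank m \<times>\<times> T)"
    by (rule DirProd_group[OF F T.is_group])
  then show ?thesis
  proof (rule group.group_comm_groupI)
    fix x y assume xy: "x \<in> carrier (free_abelian_rank m \<times>\<times> T)" "y \<in> carrier (free_abelian_rank m \<times>\<times> T)"
    have 1: "snd x \<otimes>\<^bsub>T\<^esub> snd y = snd y \<otimes>\<^bsub>T\<^esub> snd x"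
      using xy by (intro T.m_comm) (simp_all only: carrier_DirProd mem_Times_iff)
    have 2: "fst x \<otimes>\<^bsub>free_abelian_rank m\<^esub> fst y = fst y \<otimes>\<^bsub>free_abelian_rank m\<^esub> fst x"
      unfolding mult_product_group by (rule restrict_ext) (rule I.m_comm, simp_all)
    show "x \<otimes>\<^bsub>free_abelian_rank m \<times>\<times> T\<^esub> y = y \<otimes>\<^bsub>free_abelian_rank m \<times>\<times> T\<^esub> x"
      unfolding mult_DirProd' 1 2 ..
  qed
qed

text \<open>Elements of the free part are extensional functions, so a box is exactly a product of
  \<open>m\<close> intervals of \<open>R + 1\<close> integers with all of \<open>T\<close>.\<close>

lemma box_free_abelian_DirProd:
  assumes "finite (carrier T)"
  shows "finite {h \<in> carrier (free_abelian_rank m \<times>\<times> T). \<forall>j\<in>{..<m}. fst h j \<in> {a j..a j + int R}}" (is "finite ?A")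
    and "card {h \<in> carrier (free_abelian_rank m \<times>\<times> T). \<forall>j\<in>{..<m}. fst h j \<in> {a j..a j + int R}}
           \<le> card (carrier T) * (R + 1) ^ m"
proof -
  let ?B = "(\<Pi>\<^sub>E j\<in>{..<m}. {a j..a j + int R}) \<times> carrier T"
  have eq: "?A = ?B" by (auto simp: PiE_iff)
  have "finite (\<Pi>\<^sub>E j\<in>{..<m}. {a j..a j + int R})" by (intro finite_PiE) auto
  then show "finite ?A" unfolding eq using assms by simp
  have "nat (int R + 1) = R + 1" by simp
  then show "card ?A \<le> card (carrier T) * (R + 1) ^ m"
    unfolding eq by (simp add: card_cartesian_product card_PiE)
qed

theorem theorem3:
  fixes G :: "'g monoid" and Z :: "'z monoid" and A :: "'a monoid" and T :: "'t monoid"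
    and \<iota> :: "'z \<Rightarrow> 'g" and \<pi> :: "'g \<Rightarrow> 'a" and S :: "'g set" and m :: nat
  assumes "central_extension Z \<iota> G \<pi> A"
    and "comm_group A"
    and "comm_group T" and "finite (carrier T)"
    and "Z \<cong> free_abelian_rank m \<times>\<times> T"
    and "finite S" and "S \<subseteq> carrier G" and "generate G S = carrier G"
  shows "CL G S \<preceq> (\<lambda>n. n ^ (m + 1))"
proof -
  let ?Y = "free_abelian_rank m \<times>\<times> T" and ?K = "\<iota> ` carrier Z"
  interpret Z: group Z using assms(1) by (simp add: central_extension_def)
  interpret G: group G using assms(1) by (simp add: central_extension_def)
  interpret A: comm_group A by fact
  have \<iota>: "\<iota> \<in> hom Z G" "inj_on \<iota> (carrier Z)" and \<pi>: "\<pi> \<in> hom G A" and kernel: "kernel G A \<pi> = ?K"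
    and central: "\<And>z g. z \<in> carrier Z \<Longrightarrow> g \<in> carrier G \<Longrightarrow> \<iota> z \<otimes>\<^bsub>G\<^esub> g = g \<otimes>\<^bsub>G\<^esub> \<iota> z"
    using assms(1) by (auto simp: central_extension_def mon_def epi_def)
  interpret \<pi>: group_hom G A \<pi> by unfold_locales (rule \<pi>)
  interpret central_commutators G ?K
  proof (intro central_commutators.intro central_commutators_axioms.intro G.is_group)
    show "subgroup ?K G" using \<pi>.subgroup_kernel kernel by simp
  next
    fix z g assume "z \<in> ?K" "g \<in> carrier G"
    then show "z \<otimes>\<^bsub>G\<^esub> g = g \<otimes>\<^bsub>G\<^esub> z" by (auto intro: central)
  next
    fix g h assume [simp]: "g \<in> carrier G" "h \<in> carrier G"
    \<comment> \<open>Commutators die in the abelian group \<open>A\<close>, so exactness places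
      them in the image of \<open>Z\<close>.\<close>
    have "\<pi> (commutator G g h) = inv\<^bsub>A\<^esub> \<pi> g \<otimes>\<^bsub>A\<^esub> inv\<^bsub>A\<^esub> \<pi> h \<otimes>\<^bsub>A\<^esub> (\<pi> g \<otimes>\<^bsub>A\<^esub> \<pi> h)"
      by (simp add: commutator_def A.m_assoc)
    also have "\<dots> = \<one>\<^bsub>A\<^esub>"
      by (simp add: A.inv_mult[symmetric])
    finally show "commutator G g h \<in> ?K"
      unfolding kernel[symmetric] by (simp add: Coset.kernel_def commutator_def)
  qed
  obtain \<psi> where \<psi>: "\<psi> \<in> hom Z ?Y" "inj_on \<psi> (carrier Z)"
    using assms(5) by (auto simp: is_iso_def iso_def bij_betw_def)
  \<comment> \<open>Undoes the embedding \<open>\<iota>\<close> and then applies the isomorphism,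
    giving the coordinates of a central element.\<close>
  define \<rho> where "\<rho> z = \<psi> (inv_into (carrier Z) \<iota> z)" for z
  have \<rho>_\<iota>: "\<rho> (\<iota> z) = \<psi> z" if "z \<in> carrier Z" for z
    using that \<iota>(2) by (simp add: \<rho>_def)
  show ?thesis
  proof (rule CL_asymp_le[where Y = ?Y and \<rho> = \<rho> and q = "\<lambda>j h. fst h j" and \<tau> = "card (carrier T)"])
    show "comm_group ?Y" using assms(3) by (rule comm_group_free_abelian_DirProd)
    show "\<rho> \<in> ?K \<rightarrow> carrier ?Y" using \<psi>(1) by (auto simp: \<rho>_\<iota> hom_def Pi_iff simp del: carrier_DirProd)
    show "inj_on \<rho> ?K" using \<psi>(2) by (auto simp: inj_on_def \<rho>_\<iota>)
  next
    fix z z' assume "z \<in> ?K" "z' \<in> ?K"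
    then obtain x y where xy: "x \<in> carrier Z" "y \<in> carrier Z" "z = \<iota> x" "z' = \<iota> y" by auto
    then have "z \<otimes>\<^bsub>G\<^esub> z' = \<iota> (x \<otimes>\<^bsub>Z\<^esub> y)" using \<iota>(1) by (simp add: hom_mult)
    then show "\<rho> (z \<otimes>\<^bsub>G\<^esub> z') = \<rho> z \<otimes>\<^bsub>?Y\<^esub> \<rho> z'"
      using xy hom_mult[OF \<psi>(1)] by (simp add: \<rho>_\<iota>)
  next
    fix j :: nat and a b assume "j < m" "a \<in> carrier ?Y" "b \<in> carrier ?Y"
    then show "fst (a \<otimes>\<^bsub>?Y\<^esub> b) j = fst a j + fst b j" by (simp add: mult_DirProd')
  qed (rule assms box_free_abelian_DirProd)+
qed

end
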